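(* Let $\omega$ be the two-dimensional Toeplitz array constructed as described in the context (from any $h>0$ and any choices of parameters and enumerations satisfying the stated requirements). Then the Toeplitz system $(\overline{O(\omega)},T)$, where $\overline{O(\omega)}$ is the orbit closure of $\omega$ under the $\mathbb{Z}^2$-shift $T$, has positive topological entropy.
   Context: **Shift and entropy.** For a finite alphabet $\Sigma$, $\mathbb{Z}^2$ acts on $\Sigma^{\mathbb{Z}^2}$ (product topology) by $T^z(x)=\{x(z+v)\}_{v\in\mathbb{Z}^2}$; $\overline{O(\omega)}$ is the closure of $\{T^z\omega:z\in\mathbb{Z}^2\}$. The topological entropy of $(\overline{O(\omega)},T)$ is $\lim_{n\to\infty}\frac{\log\Theta(n)}{n^2}$, where $\Theta(n)$ is the number of distinct $n\times n$ square blocks appearing in $\omega$. **Parameters.** Let $h>0$ and let $l_0$ be a positive integer with $\log(l_0-1)\le h\le\log(l_0)$. Let $\varepsilon_i>0$ ($i\ge0$) satisfy $\sum_{i=0}^\infty\varepsilon_i<h/2$. Inductively, for $k\ge 0$, choose a positive integer $q_k$ such that $$\frac{\log\left(l_k^{q_k^2}\right)}{(q_k+2)^2}\ \ge\ \log(l_k)-\frac{\varepsilon_k}{2}\qquad\text{and}\qquad q_k^2\ge l_k,$$ and set $l_{k+1}=l_k^{q_k^2}$, $\lambda_k=q_k+2$. Put $P_k=\lambda_0\lambda_1\cdots\lambda_k$. The alphabet is $\Sigma=\{0,1,\dots,l_0-1\}$. **Blocks.** A block of side length $n$ is indexed by $(i,j)\in\{0,\dots,n-1\}^2$, $(0,0)$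 being the bottom-left entry, $i$ the horizontal and $j$ the vertical coordinate. For each $k\ge0$, let $B_i^{(k)}$, $0\le i\le l_{k+1}-1$, be an enumeration of all $q_k\times q_k$ square blocks over the alphabet $\{0,1,\dots,l_k-1\}$, chosen so that $B_0^{(k)}$ and $B_1^{(k)}$ each contain every letter of $\{0,\dots,l_k-1\}$. Framing: for a $q\times q$ block $B$, denote by $0B1$ the block of side length $n=q+2$ with $B$ in the center (positions $1\le i,j\le q$), with the symbol $0$ at all positions $(0,j)$, $0\le j\le n-1$, and $(i,0)$, $0\le i\le n-2$, and with the symbol $1$ at all positions $(n-1,j)$, $0\le j\le n-1$, and $(i,n-1)$, $1\le i\le n-1$. Set $C_i^{(k)}=0B_i^{(k)}1$ for $0\le i\le l_{k+1}-1$. Substitution operation: if $D_0,\dots,D_{m-1}$ are square blocks of the same side length and $B$ is a square block over $\{0,\dots,m-1\}$, then $\{D_0,\dots,D_{m-1}\}*B$ is the square block obtained from $B$ by replacing the entry at each position $(i,j)$ by the block $D_{B(i,j)}$. Define $A_i^{(0)}=C_i^{(0)}$ for $0\le i\le l_1-1$ and, for $k\ge1$ and $0\le i\le l_{k+1}-1$, $$A_i^{(k)}=\{A_0^{(k-1)},A_1^{(k-1)},\dots,A_{l_k-1}^{(k-1)}\}*C_i^{(k)}.$$ Thus $A_i^{(k)}$ is a block over $\Sigma$ of side length $P_k$. **Blocks with holes.** Let $A_0$ be the block of side length $q_0+2$ with the same frame of $0$'s and $1$'s as in $0B1$ and with the central $q_0\times q_0$ square consisting entirely of holes (unfilled positions).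 For $k\ge 0$, let $A_{k+1}$ be the block of side length $P_{k+1}$ consisting of a $\lambda_{k+1}\times\lambda_{k+1}$ arrangement of blocks of side length $P_k$: the central $q_{k+1}\times q_{k+1}$ arrangement consists of copies of $A_k$, surrounded by a frame in which $A_0^{(k)}$ is placed at the positions where the frame of $0B1$ (with $q=q_{k+1}$) has the symbol $0$, and $A_1^{(k)}$ is placed at the positions where it has the symbol $1$. **The array $\omega$.** $\omega\in\Sigma^{\mathbb{Z}^2}$ is the limiting array of this process: there are offsets $c_k\in\mathbb{Z}^2$ with $c_{k+1}-c_k\in P_k\mathbb{Z}^2$ such that for every $k\ge0$, every $n\in P_k\mathbb{Z}^2$ and every position $j$ of $A_k$ which is not a hole, $\omega(c_k+n+j)=A_k(j)$; and every $v\in\mathbb{Z}^2$ is, for some $k$, of the form $v=c_k+n+j$ with $n\in P_k\mathbb{Z}^2$ and $j$ a non-hole position of $A_k$. *)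

theory Defs
  imports "HOL-Analysis.Analysis"
begin

section \<open>The shift, orbit closures and entropy\<close>

definition shift :: "int \<times> int \<Rightarrow> (int \<times> int \<Rightarrow> 'a) \<Rightarrow> int \<times> int \<Rightarrow> 'a" where
  "shift z x = (\<lambda>v. x (z + v))"

text \<open>
  Symbols are natural numbers, carrying the discrete topology, so that \<open>closure\<close> is taken in
  the product topology on functions. For an array with symbols in a finite alphabet \<open>S\<close>,
  this is the closure in the full shift over \<open>S\<close>, which is closed in the ambient space.
\<close>

definition orbit_closure :: "(int \<times> int \<Rightarrow> nat) \<Rightarrow> (int \<times> int \<Rightarrow> nat) set" where
  "orbit_closure \<omega> = closure (range (\<lambda>z. shift z \<omega>))"

definition square :: "nat \<Rightarrow> (nat \<times> nat) set" where
  "square n = {..<n} \<times> {..<n}"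

definition blocks_in :: "(int \<times> int \<Rightarrow> 'a) \<Rightarrow> nat \<Rightarrow> (nat \<times> nat \<Rightarrow> 'a) set" where
  "blocks_in x n = range (\<lambda>z. \<lambda>(i, j) \<in> square n. x (z + (int i, int j)))"

definition block_count :: "(int \<times> int \<Rightarrow> 'a) set \<Rightarrow> nat \<Rightarrow> nat" where
  "block_count X n = card (\<Union>x\<in>X. blocks_in x n)"

text \<open>
  For an orbit closure, only the blocks appearing in the generating array matter; see
  \<open>has_topological_entropy_orbit_closure\<close> below.
\<close>

definition has_topological_entropy :: "(int \<times> int \<Rightarrow> 'a) set \<Rightarrow> real \<Rightarrow> bool" where
  "has_topological_entropy X e \<longleftrightarrow>
     (\<lambda>n. ln (real (block_count X n)) / (real n)\<^sup>2) \<longlonglongrightarrow> e"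

lemma blocks_in_orbit_closure:
  "(\<Union>x\<in>orbit_closure \<omega>. blocks_in x n) = blocks_in \<omega> n"
proof
  have "shift 0 \<omega> = \<omega>"
    by (simp add: shift_def)
  then have "\<omega> \<in> orbit_closure \<omega>"
    unfolding orbit_closure_def by (metis closure_subset rangeI subsetD)
  then show "blocks_in \<omega> n \<subseteq> (\<Union>x\<in>orbit_closure \<omega>. blocks_in x n)"
    by blast
next
  show "(\<Union>x\<in>orbit_closure \<omega>. blocks_in x n) \<subseteq> blocks_in \<omega> n"
  proof clarify
    fix x b
    assume x: "x \<in> orbit_closure \<omega>" and "b \<in> blocks_in x n"
    then obtain z where b: "b = (\<lambda>(i, j) \<in> square n. x (z + (int i, int j)))"
      by (auto simp: blocks_in_def)
    define U where
      "U = {y. \<forall>p\<in>square n. y (z + (int (fst p), int (snd p))) \<in> {x (z + (int (fst p), int (snd p)))}}"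
    have "open U"
      unfolding U_def
      by (rule product_topology_basis') (auto simp: square_def open_discrete)
    moreover have "x \<in> U"
      by (simp add: U_def)
    ultimately obtain w where w: "shift w \<omega> \<in> U"
      using x unfolding orbit_closure_def closure_iff_nhds_not_empty by blast
    then have "b = (\<lambda>(i, j) \<in> square n. \<omega> ((w + z) + (int i, int j)))"
      by (auto simp: b U_def shift_def restrict_def fun_eq_iff add.assoc)
    then show "b \<in> blocks_in \<omega> n"
      by (auto simp: blocks_in_def)
  qed
qed

lemma has_topological_entropy_orbit_closure:
  "has_topological_entropy (orbit_closure \<omega>) e \<longleftrightarrow>
     (\<lambda>n. ln (real (card (blocks_in \<omega> n))) / (real n)\<^sup>2) \<longlonglongrightarrow> e"
  by (simp add: has_topological_entropy_def block_count_def blocks_in_orbit_closure)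

section \<open>The parameters\<close>

primrec alph_size :: "nat \<Rightarrow> (nat \<Rightarrow> nat) \<Rightarrow> nat \<Rightarrow> nat" where
  "alph_size l0 q 0 = l0"
| "alph_size l0 q (Suc k) = alph_size l0 q k ^ ((q k)\<^sup>2)"

definition side :: "(nat \<Rightarrow> nat) \<Rightarrow> nat \<Rightarrow> nat" where
  "side q k = (\<Prod>i\<le>k. q i + 2)"

section \<open>Blocks\<close>

text \<open>
  A block of side length \<open>n\<close> is a function on pairs of natural numbers of which only the
  values on \<open>square n\<close> are relevant; the first coordinate is horizontal, the second vertical.
\<close>

definition square_blocks :: "nat \<Rightarrow> nat \<Rightarrow> (nat \<times> nat \<Rightarrow> nat) set" where
  "square_blocks n m = square n \<rightarrow>\<^sub>E {..<m}"

text \<open>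
  \<open>framed a b q B\<close> is the block \<open>aBb\<close> of side length \<open>q + 2\<close>. The left column and the
  bottom row are filled with \<open>a\<close>, the right column and the top row with \<open>b\<close>; of the two
  corners in dispute, the top left one is \<open>a\<close> and the bottom right one is \<open>b\<close>.
\<close>

definition framed :: "'a \<Rightarrow> 'a \<Rightarrow> nat \<Rightarrow> (nat \<times> nat \<Rightarrow> 'a) \<Rightarrow> nat \<times> nat \<Rightarrow> 'a" where
  "framed a b q B = (\<lambda>(i, j).
     if i = 0 then a
     else if i = q + 1 then b
     else if j = 0 then a
     else if j = q + 1 then b
     else B (i - 1, j - 1))"

text \<open>
  \<open>tile p D\<close> arranges blocks of side length \<open>p\<close>, the one in place \<open>(u, v)\<close> being \<open>D (u, v)\<close>.
\<close>

definition tile :: "nat \<Rightarrow> (nat \<times> nat \<Rightarrow> nat \<times> nat \<Rightarrow> 'a) \<Rightarrow> nat \<times> nat \<Rightarrow> 'a" where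
  "tile p D = (\<lambda>(i, j). D (i div p, j div p) (i mod p, j mod p))"

definition block_subst ::
    "nat \<Rightarrow> (nat \<Rightarrow> nat \<times> nat \<Rightarrow> 'a) \<Rightarrow> (nat \<times> nat \<Rightarrow> nat) \<Rightarrow> nat \<times> nat \<Rightarrow> 'a" where
  "block_subst p D B = tile p (\<lambda>u. D (B u))"

text \<open>\<open>A_block q B k i\<close> is $A_i^{(k)}$, where \<open>B k i\<close> is $B_i^{(k)}$.\<close>

primrec A_block ::
    "(nat \<Rightarrow> nat) \<Rightarrow> (nat \<Rightarrow> nat \<Rightarrow> nat \<times> nat \<Rightarrow> nat) \<Rightarrow> nat \<Rightarrow> nat \<Rightarrow> nat \<times> nat \<Rightarrow> nat" where
  "A_block q B 0 = (\<lambda>i. framed 0 1 (q 0) (B 0 i))"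
| "A_block q B (Suc k) =
     (\<lambda>i. block_subst (side q k) (A_block q B k) (framed 0 1 (q (Suc k)) (B (Suc k) i)))"

text \<open>\<open>A_holes q B k\<close> is the block with holes $A_k$; a hole is \<open>None\<close>.\<close>

primrec A_holes ::
    "(nat \<Rightarrow> nat) \<Rightarrow> (nat \<Rightarrow> nat \<Rightarrow> nat \<times> nat \<Rightarrow> nat) \<Rightarrow> nat \<Rightarrow> nat \<times> nat \<Rightarrow> nat option" where
  "A_holes q B 0 = framed (Some 0) (Some 1) (q 0) (\<lambda>_. None)"
| "A_holes q B (Suc k) =
     tile (side q k)
       (framed (Some \<circ> A_block q B k 0) (Some \<circ> A_block q B k 1) (q (Suc k))
          (\<lambda>_. A_holes q B k))"

definition lattice :: "nat \<Rightarrow> (int \<times> int) set" where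
  "lattice p = {(int p * s, int p * t) | s t. True}"

end

theory Submission
  imports Defs
begin

text \<open>
  The number of \<open>n \<times> n\<close> blocks of an array is monotone in \<open>n\<close>, and a \<open>kn \<times> kn\<close> block is
  determined by the $k^2$ aligned \<open>n \<times> n\<close> blocks in it, so Fekete's argument shows that the
  entropy of the orbit closure exists. For the lower bound, the blocks $A_i^{(k)}$,
  $i < l_{k+1}$, are distinct, and all of them occur in $A_0^{(k+1)}$, which is part of the frame
  of the block with holes $A_{k+2}$ and so occurs in $\omega$. Hence $\omega$ has at least
  $l_{k+1}$ blocks of side $P_k$, and the choice of the $q_k$ keeps $\log(l_{k+1})/P_k^2$ above
  $h - \frac12\sum_i \varepsilon_i$.
\<close>

section \<open>Subadditivity over squares\<close>

text \<open>Rounding \<open>n\<close> up to a multiple of \<open>m\<close> costs only a factor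
  \<open>(1 + m/n)^2\<close> in the normalized quantity, and this factor tends to 1. Monotonicity
  takes the place of the remainder term in the usual argument.\<close>

lemma Fekete_square:
  fixes f :: "nat \<Rightarrow> real"
  assumes mono: "mono f" and nonneg: "\<And>n. f n \<ge> 0"
    and mult: "\<And>k n. n > 0 \<Longrightarrow> f (k * n) \<le> (real k)\<^sup>2 * f n"
  shows "(\<lambda>n. f n / (real n)\<^sup>2) \<longlonglongrightarrow> (INF n\<in>{1..}. f n / (real n)\<^sup>2)" (is "_ \<longlonglongrightarrow> ?L")
proof (rule order_tendstoI)
  have bdd: "bdd_below ((\<lambda>n. f n / (real n)\<^sup>2) ` {1..})"
    by (rule bdd_belowI2[where m = 0]) (simp add: nonneg)
  fix a assume "a < ?L"
  moreover have "?L \<le> f n / (real n)\<^sup>2" if "n \<ge> 1" for n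
    using that by (intro cINF_lower[OF bdd]) auto
  ultimately show "\<forall>\<^sub>F n in sequentially. a < f n / (real n)\<^sup>2"
    by (meson eventually_sequentiallyI less_le_trans)
next
  fix a assume "?L < a"
  moreover have "bdd_below ((\<lambda>n. f n / (real n)\<^sup>2) ` {1..})"
    by (rule bdd_belowI2[where m = 0]) (simp add: nonneg)
  ultimately obtain m where m: "m \<ge> 1" "f m / (real m)\<^sup>2 < a"
    by (subst (asm) cINF_less_iff) auto
  have bound: "f n / (real n)\<^sup>2 \<le> (1 + real m / real n)\<^sup>2 * (f m / (real m)\<^sup>2)" if n: "n \<ge> 1" for n
  proof -
    have "real (n div m) * real m \<le> real n"
      by (metis of_nat_mono of_nat_mult div_times_less_eq_dividend)
    then have "real (n div m + 1) \<le> (real n + real m) / real m"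
      using m(1) by (simp add: field_simps)
    \<comment> \<open>Rounding up adds one full copy of \<open>m\<close>, even when \<open>m\<close>
      divides \<open>n\<close>; the loss is harmless in the limit.\<close>
    have "n \<le> (n div m + 1) * m"
      using m(1) dividend_less_div_times[of m n] by simp
    then have "f n \<le> f ((n div m + 1) * m)"
      by (rule monoD[OF mono])
    also have "\<dots> \<le> (real (n div m + 1))\<^sup>2 * f m"
      using m(1) by (intro mult) simp
    also have "\<dots> \<le> ((real n + real m) / real m)\<^sup>2 * f m"
      using \<open>real (n div m + 1) \<le> _\<close> nonneg
      by (intro mult_right_mono power_mono) auto
    finally have "f n / (real n)\<^sup>2 \<le> ((real n + real m) / real m)\<^sup>2 * f m / (real n)\<^sup>2"
      by (rule divide_right_mono) simp
    also have "\<dots> = (1 + real m / real n)\<^sup>2 * (f m / (real m)\<^sup>2)"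
    proof -
      have "1 + real m / real n = (real n + real m) / real n"
        using n by (simp add: field_simps)
      then show ?thesis
        by (simp add: power_divide)
    qed
    finally show ?thesis .
  qed
  have "(\<lambda>n. (1 + real m / real n)\<^sup>2 * (f m / (real m)\<^sup>2))
      \<longlonglongrightarrow> (1 + 0)\<^sup>2 * (f m / (real m)\<^sup>2)"
    by (intro tendsto_intros lim_const_over_n)
  then have "\<forall>\<^sub>F n in sequentially. (1 + real m / real n)\<^sup>2 * (f m / (real m)\<^sup>2) < a"
    using m(2) by (intro order_tendstoD) auto
  then show "\<forall>\<^sub>F n in sequentially. f n / (real n)\<^sup>2 < a"
    using eventually_ge_at_top[of 1]
  proof eventually_elim
    case (elim n)
    then show ?case
      using bound[of n] by linarith
  qed
qed

section \<open>Counting the blocks of an array\<close>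

lemma blocks_in_nonempty [simp]: "blocks_in x n \<noteq> {}"
  by (simp add: blocks_in_def)

lemma finite_blocks_in:
  assumes "finite (range x)"
  shows "finite (blocks_in x n)"
proof (rule finite_subset)
  show "blocks_in x n \<subseteq> square n \<rightarrow>\<^sub>E range x"
    by (auto simp: blocks_in_def)
  show "finite (square n \<rightarrow>\<^sub>E range x)"
    using assms by (intro finite_PiE) (auto simp: square_def)
qed

lemma card_blocks_in_mono:
  assumes "finite (range x)" and "m \<le> n"
  shows "card (blocks_in x m) \<le> card (blocks_in x n)"
proof -
  have "square m \<subseteq> square n"
    using \<open>m \<le> n\<close> by (auto simp: square_def)
  \<comment> \<open>Each small block is the bottom-left corner of the large block read at the same
    position \<open>z\<close>.\<close>
  then have "blocks_in x m = (\<lambda>b. restrict b (square m)) ` blocks_in x n"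
    by (auto simp: blocks_in_def image_image Int_absorb1 intro!: image_cong)
  then show ?thesis
    by (simp add: card_image_le finite_blocks_in assms(1))
qed

text \<open>Cutting a large block into its \<open>k^2\<close> aligned subblocks loses no
  information, and each subblock again occurs in \<open>x\<close>.\<close>

lemma card_blocks_in_mult:
  assumes fin: "finite (range x)" and m: "m > 0"
  shows "card (blocks_in x (k * m)) \<le> card (blocks_in x m) ^ k\<^sup>2"
proof -
  \<comment> \<open>The outer restriction places \<open>cut b\<close> in a
    \<open>\<rightarrow>\<^sub>E\<close> space, the inner one gives each piece the extensional form
    used by \<open>blocks_in\<close>.\<close>
  define cut where "cut = (\<lambda>(b :: nat \<times> nat \<Rightarrow> 'a).
    \<lambda>(u, v) \<in> square k. \<lambda>(i, j) \<in> square m. b (u * m + i, v * m + j))"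
  have in_square: "(u * m + i, v * m + j) \<in> square (k * m)"
    if "(u, v) \<in> square k" "(i, j) \<in> square m" for u v i j
  proof -
    have "u * m + i < k * m" if "u < k" "i < m" for u i
    proof -
      have "u * m + i < Suc u * m" using that by simp
      also have "\<dots> \<le> k * m" using that by (intro mult_right_mono) auto
      finally show ?thesis .
    qed
    then show ?thesis
      using that by (auto simp: square_def)
  qed
  have "cut ` blocks_in x (k * m) \<subseteq> square k \<rightarrow>\<^sub>E blocks_in x m"
  proof clarify
    fix b assume "b \<in> blocks_in x (k * m)"
    then obtain z where z: "b = (\<lambda>(i, j) \<in> square (k * m). x (z + (int i, int j)))"
      by (auto simp: blocks_in_def)
    show "cut b \<in> square k \<rightarrow>\<^sub>E blocks_in x m"
    proof (rule PiE_I)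
      fix w assume w: "w \<in> square k"
      obtain u v where [simp]: "w = (u, v)"
        by fastforce
      have "cut b w = (\<lambda>(i, j) \<in> square m. x (z + (int (u * m), int (v * m)) + (int i, int j)))"
        using w by (auto simp: cut_def z in_square fun_eq_iff add.assoc)
      then show "cut b w \<in> blocks_in x m"
        by (auto simp: blocks_in_def)
    qed (simp add: cut_def)
  qed
  moreover have "inj_on cut (blocks_in x (k * m))"
  proof (rule inj_onI)
    fix b b' assume b: "b \<in> blocks_in x (k * m)" "b' \<in> blocks_in x (k * m)" and eq: "cut b = cut b'"
    have ext: "b \<in> extensional (square (k * m))" "b' \<in> extensional (square (k * m))"
      using b by (auto simp: blocks_in_def)
    show "b = b'"
    proof (rule extensionalityI[OF ext])
      fix w assume "w \<in> square (k * m)"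
      then obtain i j where w: "w = (i, j)" "i < k * m" "j < k * m"
        by (auto simp: square_def)
      \<comment> \<open>Division with remainder finds the subblock that holds the entry
        \<open>w\<close> and its place there.\<close>
      then have "(i div m, j div m) \<in> square k" "(i mod m, j mod m) \<in> square m"
        using m by (auto simp: square_def less_mult_imp_div_less)
      moreover have "cut b (i div m, j div m) (i mod m, j mod m)
          = cut b' (i div m, j div m) (i mod m, j mod m)"
        by (simp add: eq)
      ultimately show "b w = b' w"
        by (simp add: cut_def w(1))
    qed
  qed
  moreover have "finite (square k \<rightarrow>\<^sub>E blocks_in x m)"
    using fin by (intro finite_PiE finite_blocks_in) (auto simp: square_def)
  ultimately have "card (blocks_in x (k * m)) \<le> card (square k \<rightarrow>\<^sub>E blocks_in x m)"
    by (meson card_inj_on_le)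
  also have "\<dots> = card (blocks_in x m) ^ k\<^sup>2"
    by (simp add: card_PiE square_def power2_eq_square)
  finally show ?thesis .
qed

text \<open>Taking logarithms turns the power bound of \<open>card_blocks_in_mult\<close> into the
  hypothesis \<open>mult\<close> of \<open>Fekete_square\<close>; the counts are positive, so
  \<open>ln\<close> is monotone and nonnegative on them.\<close>

lemma has_topological_entropy_blocks:
  assumes fin: "finite (range \<omega>)"
  shows "has_topological_entropy (orbit_closure \<omega>)
    (INF n\<in>{1..}. ln (real (card (blocks_in \<omega> n))) / (real n)\<^sup>2)"
  unfolding has_topological_entropy_orbit_closure
proof (rule Fekete_square)
  have pos: "card (blocks_in \<omega> n) > 0" for n
    by (simp add: card_gt_0_iff finite_blocks_in fin)
  show "mono (\<lambda>n. ln (real (card (blocks_in \<omega> n))))"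
    using pos by (intro monoI) (simp add: card_blocks_in_mono fin)
  show "ln (real (card (blocks_in \<omega> n))) \<ge> 0" for n
    using pos[of n] by simp
  fix k n :: nat assume "n > 0"
  then have "real (card (blocks_in \<omega> (k * n))) \<le> real (card (blocks_in \<omega> n)) ^ k\<^sup>2"
    using card_blocks_in_mult[OF fin] by (metis of_nat_le_iff of_nat_power)
  then have "ln (real (card (blocks_in \<omega> (k * n)))) \<le> ln (real (card (blocks_in \<omega> n)) ^ k\<^sup>2)"
    using pos by (subst ln_le_cancel_iff) auto
  then show "ln (real (card (blocks_in \<omega> (k * n)))) \<le> (real k)\<^sup>2 * ln (real (card (blocks_in \<omega> n)))"
    using pos[of n] by (simp add: ln_realpow)
qed

section \<open>Side lengths, frames and substitution\<close>

lemma side_0 [simp]: "side q 0 = q 0 + 2"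
  by (simp add: side_def)

lemma side_Suc [simp]: "side q (Suc k) = side q k * (q (Suc k) + 2)"
  by (simp add: side_def)

lemma side_pos [simp]: "side q k > 0"
  by (simp add: side_def prod_pos)

text \<open>Allows the entropy limit to be taken along the side lengths.\<close>

lemma strict_mono_side: "strict_mono (side q)"
proof (intro strict_monoI_Suc)
  show "side q k < side q (Suc k)" for k
    using side_pos[of q k] by simp
qed

lemma framed_center: "i < q \<Longrightarrow> j < q \<Longrightarrow> framed a b q B (Suc i, Suc j) = B (i, j)"
  by (simp add: framed_def)

lemma framed_0_0 [simp]: "framed a b q B (0, 0) = a"
  by (simp add: framed_def)

lemma framed_in:
  assumes "a \<in> S" "b \<in> S" "B ` square q \<subseteq> S"
  shows "framed a b q B ` square (q + 2) \<subseteq> S"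
  using assms by (auto simp: framed_def square_def image_subset_iff)

lemma tile_at: "i < p \<Longrightarrow> j < p \<Longrightarrow> tile p D (u * p + i, v * p + j) = D (u, v) (i, j)"
  by (simp add: tile_def)

text \<open>The tile at place \<open>w\<close> of the substituted block determines the symbol
  \<open>B w\<close>, since distinct symbols have tiles that differ somewhere on
  \<open>square p\<close>.\<close>

lemma block_subst_inj:
  assumes D: "\<And>a b. a < m \<Longrightarrow> b < m \<Longrightarrow> \<forall>w\<in>square p. D a w = D b w \<Longrightarrow> a = b"
    and B: "B ` square n \<subseteq> {..<m}" "B' ` square n \<subseteq> {..<m}"
    and eq: "\<forall>w\<in>square (p * n). block_subst p D B w = block_subst p D B' w"
    and w: "w \<in> square n"
  shows "B w = B' w"
proof (rule D)
  show "B w < m" "B' w < m"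
    using B w by auto
  obtain u v where uv: "w = (u, v)" "u < n" "v < n"
    using w by (auto simp: square_def)
  have lt: "u * p + i < p * n" if "u < n" "i < p" for u i
  proof -
    have "u * p + i < Suc u * p" using that by simp
    also have "\<dots> \<le> n * p" using that by (intro mult_right_mono) auto
    finally show ?thesis by (simp add: mult.commute)
  qed
  show "\<forall>x\<in>square p. D (B w) x = D (B' w) x"
  proof clarify
    fix i j assume "(i, j) \<in> square p"
    then have ij: "i < p" "j < p"
      by (auto simp: square_def)
    then have "(u * p + i, v * p + j) \<in> square (p * n)"
      using uv lt by (simp add: square_def)
    with eq show "D (B w) (i, j) = D (B' w) (i, j)"
      using ij by (metis block_subst_def tile_at uv(1))
  qed
qed

text \<open>Ensures that the frame symbols 0 and 1 belong to the alphabet of every level.\<close>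

lemma alph_size_ge_2:
  assumes "l0 \<ge> 2" and "\<And>k. q k > 0"
  shows "alph_size l0 q k \<ge> 2"
proof (induction k)
  case (Suc k)
  have "alph_size l0 q k ^ 1 \<le> alph_size l0 q k ^ (q k)\<^sup>2"
    using Suc assms(2)[of k] by (intro power_increasing) auto
  then show ?case
    using Suc by simp
qed (use assms in simp)

section \<open>Distinctness and occurrence of the filled blocks\<close>

text \<open>By the induction hypothesis the tiles of the previous level are distinct, so equal
  blocks come from equal framed blocks. The frames agree for all indices, hence the centers agree,
  and the enumeration \<open>B k\<close> is injective.\<close>

lemma A_block_inj:
  assumes l0: "l0 \<ge> 2" and q: "\<And>k. q k > 0"
    and B: "\<And>k. bij_betw (B k) {..<alph_size l0 q (Suc k)} (square_blocks (q k) (alph_size l0 q k))"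
  shows "\<lbrakk>a < alph_size l0 q (Suc k); b < alph_size l0 q (Suc k);
    \<forall>w\<in>square (side q k). A_block q B k a w = A_block q B k b w\<rbrakk> \<Longrightarrow> a = b"
proof (induction k arbitrary: a b)
  have in_blocks: "B k a \<in> square_blocks (q k) (alph_size l0 q k)"
    if "a < alph_size l0 q (Suc k)" for k a
    using that B[of k] by (auto simp: bij_betw_def simp del: alph_size.simps)
  \<comment> \<open>Removing the frame is common to the base case and the induction step.\<close>
  have main: "a = b" if ab: "a < alph_size l0 q (Suc k)" "b < alph_size l0 q (Suc k)"
    and eq: "\<forall>w\<in>square (q k + 2). framed 0 1 (q k) (B k a) w = framed 0 1 (q k) (B k b) w" for k a b
  proof -
    have "B k a = B k b"
    proof (rule PiE_ext[OF in_blocks[OF ab(1), unfolded square_blocks_def]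
          in_blocks[OF ab(2), unfolded square_blocks_def]])
      fix w assume "w \<in> square (q k)"
      then obtain i j where ij: "w = (i, j)" "i < q k" "j < q k"
        by (auto simp: square_def)
      then have "(Suc i, Suc j) \<in> square (q k + 2)"
        by (simp add: square_def)
      with eq show "B k a w = B k b w"
        using ij by (metis framed_center)
    qed
    then show "a = b"
      using B[of k] ab by (auto simp: bij_betw_def inj_on_def simp del: alph_size.simps)
  qed
  {
    case 0
    then show ?case
      using main[of a 0 b] by simp
  next
    case (Suc k)
    have fr: "framed 0 1 (q (Suc k)) (B (Suc k) d) ` square (q (Suc k) + 2) \<subseteq> {..<alph_size l0 q (Suc k)}"
      if "d < alph_size l0 q (Suc (Suc k))" for d
      using in_blocks[OF that] alph_size_ge_2[of l0 q "Suc k", OF l0 q]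
      by (intro framed_in) (auto simp: square_blocks_def simp del: alph_size.simps)
    show ?case
    proof (rule main[OF Suc.prems(1,2)], intro ballI)
      fix w assume "w \<in> square (q (Suc k) + 2)"
      then show "framed 0 1 (q (Suc k)) (B (Suc k) a) w = framed 0 1 (q (Suc k)) (B (Suc k) b) w"
        using block_subst_inj[OF Suc.IH fr[OF Suc.prems(1)] fr[OF Suc.prems(2)]] Suc.prems(3)
        by simp
    qed
  }
qed

text \<open>The letter \<open>a\<close> occurs in \<open>B (Suc k) 0\<close>, so the tile
  \<open>A_block q B k a\<close> occurs in \<open>A_block q B (Suc k) 0\<close>. That block has no
  holes and fills the bottom-left corner of the frame two levels above \<open>k\<close>, where it is
  visible in \<open>\<omega>\<close>.\<close>

lemma A_block_occurs:
  assumes B: "B (Suc k) 0 ` square (q (Suc k)) = {..<m}" and "a < m"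
    and \<omega>: "\<And>i j s. \<lbrakk>(i, j) \<in> square (side q (Suc (Suc k))); A_holes q B (Suc (Suc k)) (i, j) = Some s\<rbrakk>
      \<Longrightarrow> \<omega> (c + (int i, int j)) = s"
  shows "restrict (A_block q B k a) (square (side q k)) \<in> blocks_in \<omega> (side q k)"
proof -
  let ?p = "side q k" and ?P = "side q (Suc k)"
  obtain u v where uv: "u < q (Suc k)" "v < q (Suc k)" "B (Suc k) 0 (u, v) = a"
  proof -
    have "a \<in> B (Suc k) 0 ` square (q (Suc k))"
      using B \<open>a < m\<close> by simp
    then show ?thesis
      using that by (auto simp: square_def)
  qed
  \<comment> \<open>The frame shifts the center by one tile, hence \<open>Suc u\<close> in place of
    \<open>u\<close>.\<close>
  have lt: "Suc u * ?p + i < ?P" if "u < q (Suc k)" "i < ?p" for u i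
  proof -
    have "Suc u * ?p + i < Suc (Suc u) * ?p" using that by simp
    also have "\<dots> \<le> (q (Suc k) + 2) * ?p" using that by (intro mult_right_mono) auto
    finally show ?thesis by (simp add: mult.commute)
  qed
  have corner: "\<omega> (c + (int i, int j)) = A_block q B (Suc k) 0 (i, j)" if "i < ?P" "j < ?P" for i j
  proof (rule \<omega>)
    have "?P \<le> side q (Suc (Suc k))"
      by (metis lessI less_imp_le strict_mono_side strict_monoD)
    then show "(i, j) \<in> square (side q (Suc (Suc k)))"
      using that by (simp add: square_def)
    show "A_holes q B (Suc (Suc k)) (i, j) = Some (A_block q B (Suc k) 0 (i, j))"
      using that by (simp add: tile_def del: side_Suc A_block.simps)
  qed
  have "A_block q B k a (i, j) = \<omega> (c + (int (Suc u * ?p), int (Suc v * ?p)) + (int i, int j))"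
    if "i < ?p" "j < ?p" for i j
  proof -
    have "\<omega> (c + (int (Suc u * ?p), int (Suc v * ?p)) + (int i, int j))
        = A_block q B (Suc k) 0 (Suc u * ?p + i, Suc v * ?p + j)"
      using corner[OF lt[OF uv(1) that(1)] lt[OF uv(2) that(2)]] by (simp add: add.assoc)
    also have "\<dots> = A_block q B k a (i, j)"
      using that uv by (simp add: block_subst_def tile_at framed_center del: mult_Suc)
    finally show ?thesis by simp
  qed
  then have "restrict (A_block q B k a) (square ?p) = (\<lambda>(i, j) \<in> square ?p.
      \<omega> (c + (int (Suc u * ?p), int (Suc v * ?p)) + (int i, int j)))"
    by (auto simp: square_def restrict_def fun_eq_iff)
  then show ?thesis
    unfolding blocks_in_def by blast
qed

section \<open>Growth of the alphabets relative to the side lengths\<close>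

text \<open>Level \<open>Suc k\<close> loses at most \<open>\<epsilon> (Suc k) / 2\<close>, divided
  by the square of \<open>side q k\<close>. As that square is at least 1, the losses add up to at
  most half the partial sum.\<close>

lemma ln_alph_size_side_ge:
  fixes \<epsilon> :: "nat \<Rightarrow> real"
  assumes \<epsilon>: "\<And>i. \<epsilon> i > 0"
    and ge: "\<And>k. ln (real (alph_size l0 q k ^ ((q k)\<^sup>2))) / (real (q k) + 2)\<^sup>2
              \<ge> ln (real (alph_size l0 q k)) - \<epsilon> k / 2"
  shows "ln (real (alph_size l0 q (Suc k))) / (real (side q k))\<^sup>2 \<ge> ln (real l0) - (\<Sum>i\<le>k. \<epsilon> i) / 2"
proof (induction k)
  case 0
  then show ?case
    using ge[of 0] by (simp add: add.commute)
next
  case (Suc k)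
  let ?P = "(real (side q k))\<^sup>2" and ?l = "ln (real (alph_size l0 q (Suc k)))"
  have "side q k \<ge> 1"
    using side_pos[of q k] by linarith
  then have P: "?P \<ge> 1"
    by simp
  then have "\<epsilon> (Suc k) / 2 / ?P \<le> \<epsilon> (Suc k) / 2"
    using \<epsilon>[of "Suc k"] by (simp add: field_simps)
  then have "ln (real l0) - (\<Sum>i\<le>Suc k. \<epsilon> i) / 2 \<le> ?l / ?P - \<epsilon> (Suc k) / 2 / ?P"
    using Suc by (simp add: add_divide_distrib del: alph_size.simps)
  also have "\<dots> = (?l - \<epsilon> (Suc k) / 2) / ?P"
    by (simp add: diff_divide_distrib del: alph_size.simps)
  also have "\<dots> \<le> ln (real (alph_size l0 q (Suc (Suc k)))) / (real (q (Suc k)) + 2)\<^sup>2 / ?P"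
    using ge[of "Suc k"] by (intro divide_right_mono) (simp_all only: alph_size.simps(2) zero_le_power2)
  also have "\<dots> = ln (real (alph_size l0 q (Suc (Suc k)))) / (real (side q (Suc k)))\<^sup>2"
  proof -
    have "real (side q (Suc k)) = (real (q (Suc k)) + 2) * real (side q k)"
      by (simp add: algebra_simps)
    then show ?thesis
      by (simp add: power_mult_distrib del: alph_size.simps side_Suc)
  qed
  finally show ?case .
qed

section \<open>Positivity of the entropy\<close>

theorem proposition5p1:
  fixes h :: real and l0 :: nat and \<epsilon> :: "nat \<Rightarrow> real" and q :: "nat \<Rightarrow> nat"
    and B :: "nat \<Rightarrow> nat \<Rightarrow> nat \<times> nat \<Rightarrow> nat"
    and c :: "nat \<Rightarrow> int \<times> int" and \<omega> :: "int \<times> int \<Rightarrow> nat"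
  assumes "h > 0" and "l0 > 0"
    and "ln (real l0 - 1) \<le> h" and "h \<le> ln (real l0)"
    and "\<And>i. \<epsilon> i > 0" and "summable \<epsilon>" and "(\<Sum>i. \<epsilon> i) < h / 2"
    and "\<And>k. q k > 0"
    and "\<And>k. ln (real (alph_size l0 q k ^ ((q k)\<^sup>2))) / (real (q k) + 2)\<^sup>2
              \<ge> ln (real (alph_size l0 q k)) - \<epsilon> k / 2"
    and "\<And>k. (q k)\<^sup>2 \<ge> alph_size l0 q k"
    and "\<And>k. bij_betw (B k) {..<alph_size l0 q (Suc k)} (square_blocks (q k) (alph_size l0 q k))"
    and "\<And>k i. i \<in> {0, 1} \<Longrightarrow> B k i ` square (q k) = {..<alph_size l0 q k}"
    and "range \<omega> \<subseteq> {..<l0}"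
    and "\<And>k. c (Suc k) - c k \<in> lattice (side q k)"
    and "\<And>k n i j a. \<lbrakk>n \<in> lattice (side q k); (i, j) \<in> square (side q k); A_holes q B k (i, j) = Some a\<rbrakk>
            \<Longrightarrow> \<omega> (c k + n + (int i, int j)) = a"
    and "\<And>v. \<exists>k n i j. n \<in> lattice (side q k) \<and> (i, j) \<in> square (side q k)
            \<and> A_holes q B k (i, j) \<noteq> None \<and> v = c k + n + (int i, int j)"
  shows "\<exists>e > 0. has_topological_entropy (orbit_closure \<omega>) e"
proof -
  note q = assms(8) and B = assms(11)
  \<comment> \<open>A one-letter alphabet would give \<open>h \<le> ln 1 = 0\<close>.\<close>
  have l0: "l0 \<ge> 2"
  proof (rule ccontr)
    assume "\<not> l0 \<ge> 2"
    then have "l0 = 1"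
      using assms(2) by simp
    then show False
      using assms(1,4) by simp
  qed
  have fin: "finite (range \<omega>)"
    using assms(13) by (rule finite_subset) simp
  let ?a = "\<lambda>n. ln (real (card (blocks_in \<omega> n))) / (real n)\<^sup>2"
  define e where "e = (INF n\<in>{1..}. ?a n)"
  have e: "has_topological_entropy (orbit_closure \<omega>) e"
    unfolding e_def by (rule has_topological_entropy_blocks[OF fin])
  have count: "alph_size l0 q (Suc k) \<le> card (blocks_in \<omega> (side q k))" for k
  proof -
    let ?A = "\<lambda>a. restrict (A_block q B k a) (square (side q k))"
    have "?A a \<in> blocks_in \<omega> (side q k)" if "a < alph_size l0 q (Suc k)" for a
    proof (rule A_block_occurs[where c = "c (Suc (Suc k))"])
      show "B (Suc k) 0 ` square (q (Suc k)) = {..<alph_size l0 q (Suc k)}"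
        by (rule assms(12)) simp
      \<comment> \<open>The zero translate selects the copy of the block with holes based at
        \<open>c (Suc (Suc k))\<close> itself.\<close>
      have "0 \<in> lattice (side q (Suc (Suc k)))"
        by (auto simp: lattice_def zero_prod_def)
      then show "\<omega> (c (Suc (Suc k)) + (int i, int j)) = s"
        if "(i, j) \<in> square (side q (Suc (Suc k)))" "A_holes q B (Suc (Suc k)) (i, j) = Some s" for i j s
        using assms(15)[of 0 "Suc (Suc k)" i j s] that by simp
    qed (fact that)
    moreover have "inj_on ?A {..<alph_size l0 q (Suc k)}"
    proof (rule inj_onI)
      fix a b
      assume "a \<in> {..<alph_size l0 q (Suc k)}" "b \<in> {..<alph_size l0 q (Suc k)}" and eq: "?A a = ?A b"
      moreover have "A_block q B k a w = A_block q B k b w" if "w \<in> square (side q k)" for w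
        using fun_cong[OF eq, of w] that by simp
      ultimately show "a = b"
        using A_block_inj[OF l0 q B] by blast
    qed
    ultimately have "card {..<alph_size l0 q (Suc k)} \<le> card (blocks_in \<omega> (side q k))"
      by (intro card_inj_on_le[where f = ?A] finite_blocks_in fin) auto
    then show ?thesis
      by simp
  qed
  \<comment> \<open>The constant is \<open>h\<close> minus half of the bound \<open>h / 2\<close> on
    the sum of \<open>\<epsilon>\<close>.\<close>
  have "?a (side q k) \<ge> 3 / 4 * h" for k
  proof -
    have "(\<Sum>i\<le>k. \<epsilon> i) \<le> (\<Sum>i. \<epsilon> i)"
      using assms(5,6) by (intro sum_le_suminf) (auto intro: less_imp_le)
    then have "3 / 4 * h \<le> ln (real l0) - (\<Sum>i\<le>k. \<epsilon> i) / 2"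
      using assms(4,7) by linarith
    also have "\<dots> \<le> ln (real (alph_size l0 q (Suc k))) / (real (side q k))\<^sup>2"
      by (rule ln_alph_size_side_ge[OF assms(5,9)])
    also have "\<dots> \<le> ?a (side q k)"
      using count[of k] alph_size_ge_2[of l0 q "Suc k", OF l0 q]
      by (intro divide_right_mono) (auto simp del: alph_size.simps)
    finally show ?thesis .
  qed
  \<comment> \<open>The full limit is already known to exist, so bounding one subsequence
    suffices.\<close>
  moreover have "(\<lambda>k. ?a (side q k)) \<longlonglongrightarrow> e"
    using LIMSEQ_subseq_LIMSEQ[OF e[unfolded has_topological_entropy_orbit_closure] strict_mono_side]
    by (simp add: o_def)
  ultimately have "3 / 4 * h \<le> e"
    by (intro LIMSEQ_le_const) auto
  then show ?thesis
    using e \<open>h > 0\<close> by (intro exI[of _ e]) auto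
qed

end
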